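(* Let $\mathcal H$ be a real Hilbert space, let $A:\mathcal H\to 2^{\mathcal H}$ be a maximally monotone operator such that $S=A^{-1}(0)\neq\emptyset$, and let $t_0>0$. Let $\alpha>2$ and $\lambda(t)=(1+\epsilon)\frac{t^2}{\alpha^2}$ for some $\epsilon>\frac{2}{\alpha-2}$. Let $x:[t_0,+\infty[\to\mathcal H$ be a solution of $$\ddot x(t)+\frac{\alpha}{t}\dot x(t)+A_{\lambda(t)}(x(t))=0,\qquad t>t_0.$$ Then the trajectory $x(\cdot)$ is bounded, $\|\dot x(t)\|=\mathcal O(1/t)$, $\|\ddot x(t)\|=\mathcal O(1/t^2)$ (as $t\to+\infty$), and $$\int_{t_0}^{+\infty}t\,\|\dot x(t)\|^2\,dt<+\infty.$$
   Context: For $\lambda>0$, $J_{\lambda A}=(I+\lambda A)^{-1}$ is the resolvent of $A$ with index $\lambda$ and $A_\lambda=\frac1\lambda(I-J_{\lambda A})$ is its Yosida regularization (an everywhere defined, single-valued, $\frac1\lambda$-Lipschitz operator). $S=A^{-1}(0)=\{z\in\mathcal H: 0\in Az\}$. A solution is a classical ($C^2$) solution on $[t_0,+\infty[$. *)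

theory Defs
  imports "HOL-Analysis.Analysis" "HOL-Library.Landau_Symbols"
begin

text \<open>
  A real Hilbert space is a type of sort \<open>{real_inner, banach}\<close>, and an operator
  \<open>H \<rightarrow> 2\<^sup>H\<close> is a function of type \<open>'h \<Rightarrow> 'h set\<close>.
\<close>

definition monotone_operator :: "('h::real_inner \<Rightarrow> 'h set) \<Rightarrow> bool" where
  "monotone_operator A \<longleftrightarrow>
     (\<forall>x y. \<forall>u\<in>A x. \<forall>v\<in>A y. inner (x - y) (u - v) \<ge> 0)"

definition maximally_monotone :: "('h::real_inner \<Rightarrow> 'h set) \<Rightarrow> bool" where
  "maximally_monotone A \<longleftrightarrow>
     monotone_operator A \<and>
     (\<forall>B. monotone_operator B \<longrightarrow> (\<forall>x. A x \<subseteq> B x) \<longrightarrow> B = A)"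

definition inverse_operator :: "('a \<Rightarrow> 'b set) \<Rightarrow> 'b \<Rightarrow> 'a set" where
  "inverse_operator A u = {x. u \<in> A x}"

text \<open>
  For maximally monotone \<open>A\<close> on a Hilbert space and \<open>l > 0\<close>, Minty's theorem says that the
  set-valued operator \<open>(I + l A)\<^sup>-\<^sup>1\<close> takes exactly one value at every point, so
  \<open>the_elem\<close> turns it into the usual everywhere defined map. For other \<open>A\<close> or \<open>l\<close> the value
  may be unspecified.
\<close>

definition resolvent :: "real \<Rightarrow> ('h::real_vector \<Rightarrow> 'h set) \<Rightarrow> 'h \<Rightarrow> 'h" where
  "resolvent l A x = the_elem (inverse_operator (\<lambda>y. {y + l *\<^sub>R u | u. u \<in> A y}) x)"

definition yosida :: "real \<Rightarrow> ('h::real_vector \<Rightarrow> 'h set) \<Rightarrow> 'h \<Rightarrow> 'h" where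
  "yosida l A x = (1 / l) *\<^sub>R (x - resolvent l A x)"

end

theory Submission
  imports Defs
begin

text \<open>
  Fix a zero \<open>z\<close> of \<open>A\<close> and write \<open>d = x - z\<close>. Monotonicity of \<open>A\<close> between \<open>z\<close> and the resolvent
  of \<open>x\<close> gives \<open>\<lambda> \<parallel>A\<^sub>\<lambda> x\<parallel>\<^sup>2 \<le> \<langle>A\<^sub>\<lambda> x, d\<rangle>\<close>. The equation says \<open>A\<^sub>\<lambda> x = - (x'' + (\<alpha>/t) x')\<close>, and for
  \<open>\<lambda> = (1 + \<epsilon>) t\<^sup>2/\<alpha>\<^sup>2\<close> expanding the square on the left produces the term \<open>(1 + \<epsilon>) \<parallel>x'\<parallel>\<^sup>2\<close>, which more
  than pays for the \<open>\<parallel>x'\<parallel>\<^sup>2\<close> appearing in \<open>(\<parallel>d\<parallel>\<^sup>2/2)''\<close>, and a cross term that is a multiple of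
  \<open>(\<parallel>x'\<parallel>\<^sup>2)'\<close>. Multiplying by \<open>t\<close> and collecting derivatives, with \<open>K = (1 + \<epsilon>)/\<alpha>\<close>, the function
  \<open>E(t) = t \<langle>x', d\<rangle> + (\<alpha> - 1)/2 \<parallel>d\<parallel>\<^sup>2 + K t\<^sup>2 \<parallel>x'\<parallel>\<^sup>2\<close> satisfies
  \<open>E' \<le> - (\<epsilon> - 2 K) t \<parallel>x'\<parallel>\<^sup>2\<close> (lemma \<open>lyapunov_dissipation\<close>).

  The condition \<open>\<epsilon> > 2/(\<alpha> - 2)\<close> is exactly \<open>\<epsilon> - 2 K > 0\<close>. It also forces \<open>K (\<alpha> - 1) > 1\<close>, so that \<open>E\<close>
  is a positive definite quadratic form in \<open>d\<close> and \<open>t x'\<close> (lemma \<open>lyapunov_coercive\<close>). Since \<open>E\<close>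
  decreases, \<open>d\<close> and \<open>t x'\<close> stay bounded; since \<open>E\<close> stays nonnegative, its total decrease is finite
  and bounds the integral. The bound on \<open>x''\<close> is then read off the equation, because
  \<open>\<parallel>A\<^sub>\<lambda> x\<parallel> \<le> \<parallel>d\<parallel>/\<lambda>\<close> and \<open>\<lambda>\<close> grows like \<open>t\<^sup>2\<close>.

  All this presupposes that the resolvent is everywhere defined, which is Minty's theorem. The proof
  given here uses the Fitzpatrick function
  \<open>F(x, u) = sup {\<langle>x, b\<rangle> + \<langle>a, u\<rangle> - \<langle>a, b\<rangle> | (a, b) \<in> G}\<close> of the graph \<open>G\<close>. Maximality means
  \<open>F(x, u) \<ge> \<langle>x, u\<rangle>\<close>, hence \<open>F(x, u) + (\<parallel>x\<parallel>\<^sup>2 + \<parallel>u\<parallel>\<^sup>2)/2 \<ge> 0\<close>. The left-hand side is strongly convex,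
  so it has a minimizer by completeness, and the first-order condition at the minimizer exhibits
  a point of \<open>G\<close> of the form \<open>(x, - x)\<close>, that is, a solution of \<open>0 \<in> x + A x\<close>. Scaling and translating
  \<open>A\<close> turns this into surjectivity of \<open>I + \<lambda> A\<close>.
\<close>

section \<open>Minty's theorem\<close>

text \<open>
  A possibly infinite-valued convex lower semicontinuous function is represented by its epigraph \<open>C\<close>.
  Adding half the squared norm makes every minimizing sequence Cauchy: the midpoint of two
  near-minimizers would otherwise fall below the infimum, by the parallelogram law.
\<close>

lemma strongly_convex_minimizer:
  fixes C :: "('e::{real_inner, complete_space} \<times> real) set"
  assumes "convex C" "closed C" "C \<noteq> {}"
    and lower: "\<And>z r. (z, r) \<in> C \<Longrightarrow> m \<le> r + (norm z)\<^sup>2 / 2"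
  obtains z0 r0 where "(z0, r0) \<in> C"
    and "\<And>z r. (z, r) \<in> C \<Longrightarrow> r0 + (norm z0)\<^sup>2 / 2 \<le> r + (norm z)\<^sup>2 / 2"
proof -
  define J where "J p = snd p + (norm (fst p))\<^sup>2 / 2" for p :: "'e \<times> real"
  define \<mu> where "\<mu> = Inf (J ` C)"
  have bdd: "bdd_below (J ` C)"
    using lower by (auto simp: J_def intro!: bdd_belowI2)
  have \<mu>_le: "\<mu> \<le> J p" if "p \<in> C" for p
    unfolding \<mu>_def using bdd that by (auto intro: cInf_lower)
  have "\<exists>p\<in>C. J p < \<mu> + inverse (Suc n)" for n
  proof -
    have "Inf (J ` C) < \<mu> + inverse (Suc n)" unfolding \<mu>_def by simp
    then show ?thesis using cInf_less_iff[OF _ bdd] \<open>C \<noteq> {}\<close> by auto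
  qed
  then obtain p where pC: "\<And>n. p n \<in> C" and pJ: "\<And>n. J (p n) < \<mu> + inverse (Suc n)"
    by metis
  have J_lim: "(\<lambda>n. J (p n)) \<longlonglongrightarrow> \<mu>"
  proof (rule tendsto_sandwich)
    show "\<forall>\<^sub>F n in sequentially. \<mu> \<le> J (p n)" using \<mu>_le pC by simp
    show "\<forall>\<^sub>F n in sequentially. J (p n) \<le> \<mu> + inverse (real (Suc n))"
      using pJ by (simp add: less_imp_le)
    show "(\<lambda>n. \<mu> + inverse (real (Suc n))) \<longlonglongrightarrow> \<mu>"
      using tendsto_add[OF tendsto_const LIMSEQ_inverse_real_of_nat] by simp
  qed simp
  have gap: "(norm (fst q - fst q'))\<^sup>2 \<le> 4 * ((J q - \<mu>) + (J q' - \<mu>))"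
    if "q \<in> C" "q' \<in> C" for q q'
  proof -
    have mid: "(1/2) *\<^sub>R q + (1/2) *\<^sub>R q' \<in> C"
      using \<open>convex C\<close> that by (intro convexD) auto
    have "J ((1/2) *\<^sub>R q + (1/2) *\<^sub>R q')
        = (J q + J q') / 2 - (norm (fst q - fst q'))\<^sup>2 / 8"
      unfolding J_def power2_norm_eq_inner
      by (simp add: inner_simps inner_commute field_simps)
    with \<mu>_le[OF mid] show ?thesis by (simp add: field_simps)
  qed
  have "Cauchy (\<lambda>n. fst (p n))"
  proof (rule metric_CauchyI)
    fix e :: real assume "e > 0"
    then have "e\<^sup>2 / 8 > 0" by simp
    from LIMSEQ_D[OF J_lim this] obtain N where
      N: "\<And>n. n \<ge> N \<Longrightarrow> norm (J (p n) - \<mu>) < e\<^sup>2 / 8" by auto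
    have "dist (fst (p i)) (fst (p j)) < e" if "i \<ge> N" "j \<ge> N" for i j
    proof -
      have "J (p i) - \<mu> < e\<^sup>2 / 8" "J (p j) - \<mu> < e\<^sup>2 / 8"
        using N[OF that(1)] N[OF that(2)] unfolding real_norm_def by linarith+
      then have "(norm (fst (p i) - fst (p j)))\<^sup>2 < e\<^sup>2"
        using gap[OF pC pC, of i j] by argo
      then show ?thesis using \<open>e > 0\<close> by (simp add: dist_norm power2_less_imp_less)
    qed
    then show "\<exists>N. \<forall>i\<ge>N. \<forall>j\<ge>N. dist (fst (p i)) (fst (p j)) < e" by blast
  qed
  then obtain z0 where z0: "(\<lambda>n. fst (p n)) \<longlonglongrightarrow> z0"
    using Cauchy_convergent_iff convergent_def by blast
  define r0 where "r0 = \<mu> - (norm z0)\<^sup>2 / 2"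
  have "(\<lambda>n. J (p n) - (norm (fst (p n)))\<^sup>2 / 2) \<longlonglongrightarrow> r0"
    unfolding r0_def by (intro tendsto_intros J_lim z0) simp
  then have "(\<lambda>n. snd (p n)) \<longlonglongrightarrow> r0" by (simp add: J_def)
  then have "(\<lambda>n. (fst (p n), snd (p n))) \<longlonglongrightarrow> (z0, r0)" by (intro tendsto_Pair z0)
  then have "(z0, r0) \<in> C"
    using \<open>closed C\<close> pC by (auto intro: closed_sequentially)
  then show ?thesis
    using that[of z0 r0] \<mu>_le by (force simp: r0_def J_def)
qed

text \<open>
  The first-order condition at the minimizer: compare it with the point at parameter \<open>s\<close> on the
  segment towards \<open>(z, r)\<close>, divide by \<open>s\<close> and let \<open>s\<close> tend to \<open>0\<close>.
\<close>

lemma strongly_convex_minimizer_optimality: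
  fixes C :: "('e::real_inner \<times> real) set"
  assumes "convex C" "(z0, r0) \<in> C" "(z, r) \<in> C"
    and min: "\<And>z r. (z, r) \<in> C \<Longrightarrow> r0 + (norm z0)\<^sup>2 / 2 \<le> r + (norm z)\<^sup>2 / 2"
  shows "0 \<le> r - r0 + inner z0 (z - z0)"
proof -
  define w where "w = z - z0"
  have "0 \<le> (r - r0 + inner z0 w) + s * ((norm w)\<^sup>2 / 2)" if "0 < s" "s < 1" for s
  proof -
    have "(1 - s) *\<^sub>R (z0, r0) + s *\<^sub>R (z, r) \<in> C"
      using assms that by (intro convexD) auto
    also have "(1 - s) *\<^sub>R (z0, r0) + s *\<^sub>R (z, r) = (z0 + s *\<^sub>R w, r0 + s * (r - r0))"
      by (simp add: w_def algebra_simps)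
    finally have "r0 + (norm z0)\<^sup>2 / 2 \<le> r0 + s * (r - r0) + (norm (z0 + s *\<^sub>R w))\<^sup>2 / 2"
      by (rule min)
    then have "0 \<le> s * ((r - r0 + inner z0 w) + s * ((norm w)\<^sup>2 / 2))"
      unfolding power2_norm_eq_inner
      by (simp add: inner_simps inner_commute field_simps)
    then show ?thesis using that by (simp add: zero_le_mult_iff)
  qed
  then have "\<forall>\<^sub>F s in at_right 0. 0 \<le> (r - r0 + inner z0 w) + s * ((norm w)\<^sup>2 / 2)"
    by (intro eventually_at_rightI[of 0 1]) auto
  moreover have "((\<lambda>s. (r - r0 + inner z0 w) + s * ((norm w)\<^sup>2 / 2))
      \<longlongrightarrow> (r - r0 + inner z0 w) + 0 * ((norm w)\<^sup>2 / 2)) (at_right 0)"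
    by (intro tendsto_intros)
  ultimately show ?thesis
    using tendsto_lowerbound[of _ _ "at_right (0::real)"] by (fastforce simp: w_def)
qed

text \<open>
  Maximality is defined through extensions of the whole operator; it suffices to extend the graph by
  the single pair \<open>(x, u)\<close>.
\<close>

lemma maximally_monotone_memI:
  assumes "maximally_monotone A"
    and rel: "\<And>a b. b \<in> A a \<Longrightarrow> 0 \<le> inner (x - a) (u - b)"
  shows "u \<in> A x"
proof -
  define B where "B = A(x := insert u (A x))"
  have mono: "monotone_operator A"
    using assms(1) by (simp add: maximally_monotone_def)
  have rel': "0 \<le> inner (a - x) (b - u)" if "b \<in> A a" for a b
    using rel[OF that] by (simp add: inner_diff_left inner_diff_right)
  have "monotone_operator B"
    using mono rel rel' unfolding monotone_operator_def B_def by auto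
  moreover have "\<forall>y. A y \<subseteq> B y" by (auto simp: B_def)
  ultimately have "B = A" using assms(1) by (simp add: maximally_monotone_def)
  then have "B x = A x" by simp
  then show ?thesis by (auto simp: B_def)
qed

text \<open>
  This is Minty's theorem for \<open>I + A\<close> at the origin, stated for a graph \<open>G\<close> so that it
  applies directly to the graphs of scaled and translated operators. The set \<open>C\<close>
  in the proof is the epigraph of the Fitzpatrick function \<open>F\<close>, an intersection of half-spaces. On \<open>G\<close>
  itself \<open>F(a, b) = \<langle>a, b\<rangle>\<close>, and off \<open>G\<close> maximality gives \<open>F(x, u) > \<langle>x, u\<rangle>\<close>. If \<open>(x, u)\<close> is the minimizer,
  the first-order condition tested on \<open>G\<close> reads \<open>\<parallel>x + u\<parallel>\<^sup>2/2 \<le> \<langle>a + u, b + x\<rangle>\<close>: so \<open>(- u, - x)\<close> is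
  monotonically related to \<open>G\<close> and belongs to it, and testing with that very pair gives \<open>u = - x\<close>.
\<close>

lemma maximal_monotone_graph_meets_antidiagonal:
  fixes G :: "('h::{real_inner, complete_space} \<times> 'h) set"
  assumes mono: "\<And>a b a' b'. (a, b) \<in> G \<Longrightarrow> (a', b') \<in> G \<Longrightarrow> 0 \<le> inner (a - a') (b - b')"
    and max: "\<And>x u. (\<And>a b. (a, b) \<in> G \<Longrightarrow> 0 \<le> inner (x - a) (u - b)) \<Longrightarrow> (x, u) \<in> G"
  shows "\<exists>x. (x, - x) \<in> G"
proof -
  define C where
    "C = {((x, u), r) | x u r. \<forall>(a, b)\<in>G. inner x b + inner a u - inner a b \<le> r}"
  have C_iff: "((x, u), r) \<in> C \<longleftrightarrow> (\<forall>(a, b)\<in>G. inner x b + inner a u - inner a b \<le> r)" for x u r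
    by (simp add: C_def)
  have C_Int: "C = (\<Inter>q\<in>G. {p. inner (fst (fst p)) (snd q) + inner (fst q) (snd (fst p))
      - inner (fst q) (snd q) \<le> snd p})"
    by (force simp: C_def)
  have "closed C"
    unfolding C_Int by (auto intro!: closed_INT closed_Collect_le continuous_intros)
  have "convex C"
    unfolding C_Int
  proof (intro convex_INT, clarify)
    fix a b :: 'h
    show "convex {p :: ('h \<times> 'h) \<times> real.
        inner (fst (fst p)) b + inner a (snd (fst p)) - inner a b \<le> snd p}"
    proof (rule convexI, clarsimp simp: inner_simps)
      fix x u y v and r q s t :: real
      assume h: "inner x b + inner a u - inner a b \<le> r" "inner y b + inner a v - inner a b \<le> q"
        and st: "0 \<le> s" "0 \<le> t" "s + t = 1"
      have "s * (inner x b + inner a u - inner a b) + t * (inner y b + inner a v - inner a b)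
          \<le> s * r + t * q"
        using h st by (intro add_mono mult_left_mono) auto
      moreover have "s * inner a b + t * inner a b = inner a b"
        using st by (metis distrib_right mult_1)
      ultimately show "s * inner x b + t * inner y b + (s * inner a u + t * inner a v) - inner a b
          \<le> s * r + t * q"
        by (simp add: algebra_simps)
    qed
  qed
  have graph_in_C: "((a, b), inner a b) \<in> C" if "(a, b) \<in> G" for a b
    unfolding C_iff
  proof clarify
    fix a' b' assume "(a', b') \<in> G"
    from mono[OF that this] show "inner a b' + inner a' b - inner a' b' \<le> inner a b"
      by (simp add: inner_simps)
  qed
  have "G \<noteq> {}" using max by blast
  then have "C \<noteq> {}" using graph_in_C by (metis equals0I ex_in_conv surj_pair)
  have C_above: "inner x u \<le> r" if "((x, u), r) \<in> C" for x u r
  proof (cases "(x, u) \<in> G")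
    case True
    with that show ?thesis unfolding C_iff by fastforce
  next
    case False
    with max obtain a b where ab: "(a, b) \<in> G" "inner (x - a) (u - b) < 0"
      by (meson not_le)
    with that have "inner x b + inner a u - inner a b \<le> r" unfolding C_iff by blast
    with ab(2) show ?thesis by (simp add: inner_simps)
  qed
  have norm_pair: "(norm z)\<^sup>2 = (norm (fst z))\<^sup>2 + (norm (snd z))\<^sup>2" for z :: "'h \<times> 'h"
    by (simp add: norm_prod_def)
  have C_nonneg: "0 \<le> r + (norm z)\<^sup>2 / 2" if "(z, r) \<in> C" for z r
  proof -
    obtain x u where z: "z = (x, u)" by (cases z)
    have "0 \<le> (norm (x + u))\<^sup>2" by simp
    then have "0 \<le> 2 * inner x u + (norm x)\<^sup>2 + (norm u)\<^sup>2"
      unfolding power2_norm_eq_inner by (simp add: inner_simps inner_commute)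
    with C_above[OF that[unfolded z]] show ?thesis by (simp add: norm_pair z field_simps)
  qed
  obtain z0 r0 where z0: "(z0, r0) \<in> C"
    and min: "\<And>z r. (z, r) \<in> C \<Longrightarrow> r0 + (norm z0)\<^sup>2 / 2 \<le> r + (norm z)\<^sup>2 / 2"
    using strongly_convex_minimizer[OF \<open>convex C\<close> \<open>closed C\<close> \<open>C \<noteq> {}\<close> C_nonneg] by blast
  obtain x u where xu: "z0 = (x, u)" by (cases z0)
  have key: "(norm (x + u))\<^sup>2 / 2 \<le> inner (a + u) (b + x)" if "(a, b) \<in> G" for a b
  proof -
    have "0 \<le> inner a b - r0 + inner z0 ((a, b) - z0)"
      using strongly_convex_minimizer_optimality[OF \<open>convex C\<close> z0 graph_in_C[OF that] min] .
    with C_nonneg[OF z0] show ?thesis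
      unfolding norm_pair xu power2_norm_eq_inner
      by (simp add: inner_simps inner_commute field_simps)
  qed
  have mem: "(- u, - x) \<in> G"
  proof (rule max)
    fix a b assume "(a, b) \<in> G"
    have "0 \<le> (norm (x + u))\<^sup>2 / 2" by simp
    also note key[OF \<open>(a, b) \<in> G\<close>]
    also have "inner (a + u) (b + x) = inner (- u - a) (- x - b)" by (simp add: inner_simps)
    finally show "0 \<le> inner (- u - a) (- x - b)" .
  qed
  from key[OF this] have "x + u = 0" by simp
  then have "- u = x" by (simp add: eq_neg_iff_add_eq_0 add.commute neg_eq_iff_add_eq_0)
  with mem show ?thesis by auto
qed

text \<open>
  Solving \<open>x = y + l u\<close> with \<open>u \<in> A y\<close> means finding \<open>- y\<close> among the values at \<open>y\<close> of the maximal
  monotone operator \<open>l A - x\<close>.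
\<close>

theorem minty:
  fixes A :: "'h::{real_inner, complete_space} \<Rightarrow> 'h set"
  assumes max: "maximally_monotone A" and l: "l > 0"
  shows "\<exists>y. \<exists>u\<in>A y. x = y + l *\<^sub>R u"
proof -
  define G where "G = {(y, l *\<^sub>R u - x) | y u. u \<in> A y}"
  have "\<exists>y. (y, - y) \<in> G"
  proof (rule maximal_monotone_graph_meets_antidiagonal)
    fix a b a' b' assume "(a, b) \<in> G" "(a', b') \<in> G"
    then obtain u u' where "u \<in> A a" "u' \<in> A a'" "b = l *\<^sub>R u - x" "b' = l *\<^sub>R u' - x"
      by (auto simp: G_def)
    moreover from this max have "0 \<le> inner (a - a') (u - u')"
      by (auto simp: maximally_monotone_def monotone_operator_def)
    ultimately show "0 \<le> inner (a - a') (b - b')"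
      using l by (simp flip: scaleR_diff_right)
  next
    fix y v assume rel: "\<And>a b. (a, b) \<in> G \<Longrightarrow> 0 \<le> inner (y - a) (v - b)"
    define u where "u = (1 / l) *\<^sub>R (v + x)"
    have v: "v = l *\<^sub>R u - x" using l by (simp add: u_def)
    have "u \<in> A y"
    proof (rule maximally_monotone_memI[OF max])
      fix a b assume "b \<in> A a"
      then have "0 \<le> inner (y - a) (v - (l *\<^sub>R b - x))" by (intro rel) (auto simp: G_def)
      then show "0 \<le> inner (y - a) (u - b)"
        using l by (simp add: v zero_le_mult_iff flip: scaleR_diff_right)
    qed
    then show "(y, v) \<in> G" by (auto simp: G_def v)
  qed
  then obtain y u where "u \<in> A y" "- y = l *\<^sub>R u - x" by (auto simp: G_def)
  then show ?thesis by (metis add.commute diff_add_cancel diff_minus_eq_add add_diff_cancel_left')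
qed

section \<open>The Yosida regularization\<close>

lemma resolvent_eqI:
  assumes mono: "monotone_operator A" and l: "l > 0" and u: "u \<in> A y"
  shows "resolvent l A (y + l *\<^sub>R u) = y"
proof -
  have "w = y" if v: "v \<in> A w" and eq: "y + l *\<^sub>R u = w + l *\<^sub>R v" for w v
  proof -
    have "w - y = l *\<^sub>R (u - v)" using eq by (simp add: algebra_simps)
    moreover have "0 \<le> inner (w - y) (v - u)"
      using mono u v by (simp add: monotone_operator_def)
    ultimately have "0 \<le> inner (l *\<^sub>R (u - v)) (v - u)" by simp
    also have "\<dots> = - (l * (norm (u - v))\<^sup>2)"
      unfolding power2_norm_eq_inner by (simp add: inner_simps inner_commute algebra_simps)
    finally have "u = v" using l by (simp add: mult_le_0_iff)
    with eq show ?thesis by simp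
  qed
  then have "inverse_operator (\<lambda>y. {y + l *\<^sub>R u | u. u \<in> A y}) (y + l *\<^sub>R u) = {y}"
    using u by (auto simp: inverse_operator_def)
  then show ?thesis by (simp add: resolvent_def)
qed

lemma yosida_mem:
  fixes A :: "'h::{real_inner, complete_space} \<Rightarrow> 'h set"
  assumes max: "maximally_monotone A" and l: "l > 0"
  shows "yosida l A x \<in> A (x - l *\<^sub>R yosida l A x)"
proof -
  obtain y u where u: "u \<in> A y" and x: "x = y + l *\<^sub>R u"
    using minty[OF max l, of x] by blast
  have "resolvent l A x = y"
    unfolding x using max l u by (intro resolvent_eqI) (auto simp: maximally_monotone_def)
  then have "yosida l A x = u" using l by (simp add: yosida_def x)
  then show ?thesis using u by (simp add: x)
qed

text \<open>
  Monotonicity of \<open>A\<close>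
  between \<open>0 \<in> A z\<close> and the value that the Yosida regularization selects at the resolvent of \<open>x\<close>
  gives \<open>0 \<le> \<langle>x - l y - z, y\<rangle>\<close> for the Yosida value \<open>y\<close>.
\<close>

lemma yosida_cocoercive_at_zero:
  fixes A :: "'h::{real_inner, complete_space} \<Rightarrow> 'h set"
  assumes max: "maximally_monotone A" and l: "l > 0" and z: "0 \<in> A z"
  shows "l * (norm (yosida l A x))\<^sup>2 \<le> inner (yosida l A x) (x - z)"
proof -
  define y where "y = yosida l A x"
  have "0 \<le> inner (x - l *\<^sub>R y - z) (y - 0)"
    using max z yosida_mem[OF max l, of x]
    unfolding maximally_monotone_def monotone_operator_def y_def by blast
  then show ?thesis
    unfolding power2_norm_eq_inner y_def[symmetric] by (simp add: inner_simps inner_commute)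
qed

lemma norm_yosida_le:
  fixes A :: "'h::{real_inner, complete_space} \<Rightarrow> 'h set"
  assumes "maximally_monotone A" and l: "l > 0" and "0 \<in> A z"
  shows "norm (yosida l A x) \<le> norm (x - z) / l"
proof (cases "yosida l A x = 0")
  case False
  have "l * (norm (yosida l A x))\<^sup>2 \<le> norm (yosida l A x) * norm (x - z)"
    using yosida_cocoercive_at_zero[OF assms] norm_cauchy_schwarz order_trans by blast
  with False l show ?thesis by (simp add: power2_eq_square field_simps)
qed (use l in simp)

section \<open>Dissipation and integrability\<close>

text \<open>
  The derivative and the inequality are asked only inside the interval, since the equation of motion
  is imposed only for times beyond the initial one.
\<close>

lemma dissipation_integral_bound:
  fixes E g :: "real \<Rightarrow> real"
  assumes "a \<le> b" and cont: "continuous_on {a..b} E" "continuous_on {a..b} g"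
    and der: "\<And>t. a < t \<Longrightarrow> t < b \<Longrightarrow> (E has_vector_derivative D t) (at t)"
    and le: "\<And>t. a < t \<Longrightarrow> t < b \<Longrightarrow> D t \<le> - g t"
  shows "integral {a..b} g \<le> E a - E b"
proof -
  \<comment> \<open>Changing \<open>D\<close> at the end points leaves its integral unchanged, and the value
      \<open>- g\<close> there makes the inequality hold on the closed interval.\<close>
  define D' where "D' t = (if a < t \<and> t < b then D t else - g t)" for t
  have "(D' has_integral E b - E a) {a..b}"
    using assms by (intro fundamental_theorem_of_calculus_interior) (auto simp: D'_def)
  moreover have "((\<lambda>t. - g t) has_integral - integral {a..b} g) {a..b}"
    using cont(2) by (intro has_integral_neg integrable_integral integrable_continuous_real)
  moreover have "D' t \<le> - g t" for t using le by (simp add: D'_def)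
  ultimately have "E b - E a \<le> - integral {a..b} g" by (auto intro: has_integral_le)
  then show ?thesis by simp
qed

text \<open>Monotone convergence along the truncations to \<open>[a, a + n]\<close>.\<close>

lemma set_integrable_atLeast_nonneg_bounded:
  fixes g :: "real \<Rightarrow> real"
  assumes cont: "continuous_on {a..} g" and nonneg: "\<And>t. a \<le> t \<Longrightarrow> 0 \<le> g t"
    and bound: "\<And>b. a \<le> b \<Longrightarrow> integral {a..b} g \<le> M"
  shows "set_integrable lborel {a..} g"
proof -
  define f where "f n t = indicator {a..a + real n} t *\<^sub>R g t" for n :: nat and t
  have si: "set_integrable lborel {a..a + real n} g" for n
    using cont by (intro borel_integrable_atLeastAtMost' continuous_on_subset[OF cont]) auto
  have int: "integrable lborel (f n)" for n
    using si[of n] unfolding set_integrable_def f_def .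
  have val: "integral\<^sup>L lborel (f n) = integral {a..a + real n} g" for n
    using set_borel_integral_eq_integral(2)[OF si[of n]]
    unfolding set_lebesgue_integral_def f_def .
  have mono: "f n t \<le> f m t" if "n \<le> m" for n m t
    using that nonneg[of t] by (auto simp: f_def indicator_def)
  have "incseq (\<lambda>n. integral\<^sup>L lborel (f n))"
    using int mono by (intro monoI integral_mono) auto
  moreover have "\<forall>n. integral\<^sup>L lborel (f n) \<le> M" using bound by (simp add: val)
  ultimately obtain L where L: "(\<lambda>n. integral\<^sup>L lborel (f n)) \<longlonglongrightarrow> L"
    by (rule incseq_convergent)
  have lim: "(\<lambda>n. f n t) \<longlonglongrightarrow> indicator {a..} t *\<^sub>R g t" for t
  proof (rule tendsto_eventually)
    obtain N where "t - a \<le> real N" using real_arch_simple by blast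
    then show "\<forall>\<^sub>F n in sequentially. f n t = indicator {a..} t *\<^sub>R g t"
      by (intro eventually_sequentiallyI[of N]) (auto simp: f_def indicator_def)
  qed
  have meas: "(\<lambda>t. indicator {a..} t *\<^sub>R g t) \<in> borel_measurable lborel"
    using int by (intro borel_measurable_LIMSEQ_real[OF lim]) auto
  show ?thesis
    unfolding set_integrable_def
    by (rule integrable_monotone_convergence[OF int _ _ L meas])
      (use mono lim in \<open>auto simp: mono_def\<close>)
qed

section \<open>The Lyapunov function\<close>

text \<open>
  Here \<open>d\<close>, \<open>v\<close>, \<open>w\<close> and \<open>y\<close> are the values at time \<open>t\<close> of \<open>x - z\<close>, \<open>x'\<close>, \<open>x''\<close> and the Yosida term, and the
  left-hand side of the conclusion is \<open>E'(t)\<close> for the Lyapunov function \<open>E\<close> introduced above. The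
  equation replaces \<open>\<alpha> \<langle>v, d\<rangle> + t \<langle>w, d\<rangle>\<close> by \<open>- t \<langle>y, d\<rangle>\<close>, which cocoercivity bounds by \<open>- t \<lambda> \<parallel>y\<parallel>\<^sup>2\<close>.
  The cross term of \<open>\<parallel>w + (\<alpha>/t) v\<parallel>\<^sup>2\<close> then cancels the \<open>\<langle>w, v\<rangle>\<close> in \<open>E'\<close>, which is what determines \<open>K\<close>.
\<close>

lemma lyapunov_dissipation:
  fixes d v w y :: "'h::real_inner"
  assumes t: "t > 0" and al: "\<alpha> > 0"
    and ode: "w + (\<alpha> / t) *\<^sub>R v + y = 0"
    and coc: "((1 + \<epsilon>) * (t\<^sup>2 / \<alpha>\<^sup>2)) * (norm y)\<^sup>2 \<le> inner y d" and eps: "\<epsilon> \<ge> - 1"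
    and K: "K = (1 + \<epsilon>) / \<alpha>"
  shows "inner v d + t * (inner w d + inner v v) + (\<alpha> - 1) * inner v d
      + K * (2 * t * inner v v + t\<^sup>2 * (2 * inner w v))
    \<le> - ((\<epsilon> - 2 * K) * (t * (norm v)\<^sup>2))"
proof -
  have y: "y = - (w + (\<alpha> / t) *\<^sub>R v)" using ode by (metis add.commute eq_neg_iff_add_eq_0)
  have "t * ((1 + \<epsilon>) * (t\<^sup>2 / \<alpha>\<^sup>2) * (norm y)\<^sup>2) \<le> t * inner y d"
    using coc t by (intro mult_left_mono) auto
  also have "t * inner y d = - t * inner w d - \<alpha> * inner v d"
    using t by (simp add: y inner_simps algebra_simps)
  also have "t * ((1 + \<epsilon>) * (t\<^sup>2 / \<alpha>\<^sup>2) * (norm y)\<^sup>2)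
      = (1 + \<epsilon>) * t^3 / \<alpha>\<^sup>2 * (norm w)\<^sup>2 + 2 * K * t\<^sup>2 * inner w v + (1 + \<epsilon>) * t * inner v v"
    using t al unfolding power2_norm_eq_inner y K
    by (simp add: inner_simps inner_commute field_simps power2_eq_square power3_eq_cube)
  finally have "2 * K * t\<^sup>2 * inner w v + (1 + \<epsilon>) * t * inner v v
      \<le> - t * inner w d - \<alpha> * inner v d - (1 + \<epsilon>) * t^3 / \<alpha>\<^sup>2 * (norm w)\<^sup>2" by simp
  moreover have "0 \<le> (1 + \<epsilon>) * t^3 / \<alpha>\<^sup>2 * (norm w)\<^sup>2" using t eps by simp
  ultimately show ?thesis
    unfolding power2_norm_eq_inner by (simp add: algebra_simps)
qed

text \<open>
  Young's inequality for \<open>t \<langle>v, d\<rangle>\<close>, with the weight chosen so that half of the \<open>\<parallel>d\<parallel>\<^sup>2\<close> term survives.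
  It is applied with \<open>\<beta> = \<alpha> - 1\<close>.
\<close>

lemma lyapunov_coercive:
  fixes d v :: "'h::real_inner"
  assumes "\<beta> > 0"
  shows "\<beta> / 4 * (norm d)\<^sup>2 + (K - 1 / \<beta>) * (t\<^sup>2 * (norm v)\<^sup>2)
    \<le> t * inner v d + \<beta> / 2 * inner d d + K * (t\<^sup>2 * inner v v)"
proof -
  have "0 \<le> \<beta> * (norm ((1 / 2) *\<^sub>R d + (t / \<beta>) *\<^sub>R v))\<^sup>2" using assms by simp
  also have "\<dots> = t * inner v d + \<beta> / 2 * inner d d + K * (t\<^sup>2 * inner v v)
      - (\<beta> / 4 * (norm d)\<^sup>2 + (K - 1 / \<beta>) * (t\<^sup>2 * (norm v)\<^sup>2))"
    using assms unfolding power2_norm_eq_inner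
    by (simp add: inner_simps inner_commute field_simps power2_eq_square)
  finally show ?thesis by simp
qed

section \<open>Boundedness and decay of the trajectory\<close>

theorem proposition2p4:
  fixes A :: "'h::{real_inner, banach} \<Rightarrow> 'h set"
    and x x' x'' :: "real \<Rightarrow> 'h"
    and t\<^sub>0 \<alpha> \<epsilon> :: real
    and lam :: "real \<Rightarrow> real"
  assumes "maximally_monotone A"
    and "inverse_operator A 0 \<noteq> {}"
    and "t\<^sub>0 > 0"
    and "\<alpha> > 2"
    and "\<epsilon> > 2 / (\<alpha> - 2)"
    and "\<And>t. lam t = (1 + \<epsilon>) * (t^2 / \<alpha>^2)"
    and "\<And>t. t \<ge> t\<^sub>0 \<Longrightarrow> (x has_vector_derivative x' t) (at t within {t\<^sub>0..})"
    and "\<And>t. t \<ge> t\<^sub>0 \<Longrightarrow> (x' has_vector_derivative x'' t) (at t within {t\<^sub>0..})"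
    and "continuous_on {t\<^sub>0..} x''"
    and "\<And>t. t > t\<^sub>0 \<Longrightarrow> x'' t + (\<alpha> / t) *\<^sub>R x' t + yosida (lam t) A (x t) = 0"
  shows "bounded (x ` {t\<^sub>0..})
    \<and> (\<lambda>t. norm (x' t)) \<in> O[at_top](\<lambda>t. 1 / t)
    \<and> (\<lambda>t. norm (x'' t)) \<in> O[at_top](\<lambda>t. 1 / t^2)
    \<and> set_integrable lborel {t\<^sub>0..} (\<lambda>t. t * (norm (x' t))^2)"
proof -
  note max = assms(1) and t0 = assms(3) and al = assms(4) and eps = assms(5)
    and lam = assms(6) and dx = assms(7) and dv = assms(8) and ode = assms(10)
  obtain z where z: "0 \<in> A z" using assms(2) by (auto simp: inverse_operator_def)
  define K where "K = (1 + \<epsilon>) / \<alpha>"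
  define c where "c = \<epsilon> - 2 * K"
  have eps0: "\<epsilon> > 0" using eps al by (smt (verit) divide_pos_pos)
  have "\<epsilon> * (\<alpha> - 2) > 2" using eps al by (simp add: field_simps)
  then have c: "c > 0" using al by (simp add: c_def K_def field_simps)
  have "K * (\<alpha> - 1) > 1"
  proof -
    have "\<epsilon> * (\<alpha> - 1) > 2" using \<open>\<epsilon> * (\<alpha> - 2) > 2\<close> eps0 by (simp add: algebra_simps)
    then show ?thesis using al by (simp add: K_def field_simps)
  qed
  then have K: "K - 1 / (\<alpha> - 1) > 0" using al by (simp add: field_simps)
  have lam_pos: "lam t > 0" if "t > 0" for t
    using that al eps0 by (simp add: lam)
  define E where "E t = t * inner (x' t) (x t - z) + (\<alpha> - 1) / 2 * inner (x t - z) (x t - z)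
      + K * (t\<^sup>2 * inner (x' t) (x' t))" for t
  define D where "D t = inner (x' t) (x t - z) + t * (inner (x'' t) (x t - z) + inner (x' t) (x' t))
      + (\<alpha> - 1) * inner (x' t) (x t - z)
      + K * (2 * t * inner (x' t) (x' t) + t\<^sup>2 * (2 * inner (x'' t) (x' t)))" for t
  define g where "g t = t * (norm (x' t))\<^sup>2" for t
  have cx: "continuous_on {t\<^sub>0..} x"
    using dx by (auto intro: has_vector_derivative_continuous simp: continuous_on_eq_continuous_within)
  have cv: "continuous_on {t\<^sub>0..} x'"
    using dv by (auto intro: has_vector_derivative_continuous simp: continuous_on_eq_continuous_within)
  have cE: "continuous_on {t\<^sub>0..} E"
    unfolding E_def by (intro continuous_intros cx cv)
  have cg: "continuous_on {t\<^sub>0..} g"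
    unfolding g_def by (intro continuous_intros cv)
  have dE: "(E has_vector_derivative D t) (at t)" if "t > t\<^sub>0" for t
  proof -
    have at: "at t within {t\<^sub>0..} = at t"
      using that by (intro at_within_interior) (simp add: interior_Ici)
    have hx: "(x has_derivative (\<lambda>h. h *\<^sub>R x' t)) (at t)"
      and hv: "(x' has_derivative (\<lambda>h. h *\<^sub>R x'' t)) (at t)"
      using dx[of t] dv[of t] that by (simp_all add: at has_vector_derivative_def)
    show ?thesis
      unfolding has_vector_derivative_def E_def
      by (rule has_derivative_eq_rhs, (rule derivative_eq_intros hx hv refl)+)
        (simp add: D_def fun_eq_iff inner_simps inner_commute field_simps)
  qed
  have D_le: "D t \<le> - (c * g t)" if "t > t\<^sub>0" for t
    unfolding D_def c_def g_def
  proof (rule lyapunov_dissipation[OF _ _ ode[OF that] _ _ K_def])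
    show "(1 + \<epsilon>) * (t\<^sup>2 / \<alpha>\<^sup>2) * (norm (yosida (lam t) A (x t)))\<^sup>2
        \<le> inner (yosida (lam t) A (x t)) (x t - z)"
      using yosida_cocoercive_at_zero[OF max lam_pos z, of t "x t"] that t0 by (simp add: lam)
  qed (use that t0 al eps0 in auto)
  have g_nonneg: "0 \<le> g t" if "t \<ge> t\<^sub>0" for t using that t0 by (simp add: g_def)
  have E_drop: "c * integral {t\<^sub>0..t} g \<le> E t\<^sub>0 - E t" if "t \<ge> t\<^sub>0" for t
  proof -
    have "integral {t\<^sub>0..t} (\<lambda>s. c * g s) \<le> E t\<^sub>0 - E t"
      using that dE D_le
      by (intro dissipation_integral_bound[where D = D] continuous_intros
          continuous_on_subset[OF cE] continuous_on_subset[OF cg]) auto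
    then show ?thesis by simp
  qed
  have E_le: "E t \<le> E t\<^sub>0" if "t \<ge> t\<^sub>0" for t
  proof -
    have "0 \<le> integral {t\<^sub>0..t} g"
      using g_nonneg by (intro integral_nonneg integrable_continuous_real
          continuous_on_subset[OF cg]) auto
    then have "0 \<le> c * integral {t\<^sub>0..t} g" using c by simp
    with E_drop[OF that] show ?thesis by simp
  qed
  have coercive: "(\<alpha> - 1) / 4 * (norm (x t - z))\<^sup>2 + (K - 1 / (\<alpha> - 1)) * (t\<^sup>2 * (norm (x' t))\<^sup>2) \<le> E t" for t
    unfolding E_def using al by (intro lyapunov_coercive) simp
  define R where "R = sqrt (E t\<^sub>0 / ((\<alpha> - 1) / 4))"
  define V where "V = sqrt (E t\<^sub>0 / (K - 1 / (\<alpha> - 1)))"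
  have x_bd: "norm (x t - z) \<le> R" if "t \<ge> t\<^sub>0" for t
  proof -
    have "0 \<le> (K - 1 / (\<alpha> - 1)) * (t\<^sup>2 * (norm (x' t))\<^sup>2)" using K by simp
    then have "(\<alpha> - 1) / 4 * (norm (x t - z))\<^sup>2 \<le> E t\<^sub>0"
      using coercive[of t] E_le[OF that] by linarith
    then have "(norm (x t - z))\<^sup>2 \<le> E t\<^sub>0 / ((\<alpha> - 1) / 4)"
      using al by (subst pos_le_divide_eq) (auto simp: mult.commute)
    then show ?thesis unfolding R_def by (rule real_le_rsqrt)
  qed
  have v_bd: "norm (x' t) \<le> V / t" if "t \<ge> t\<^sub>0" for t
  proof -
    have "0 \<le> (\<alpha> - 1) / 4 * (norm (x t - z))\<^sup>2" using al by simp
    then have "(K - 1 / (\<alpha> - 1)) * (t\<^sup>2 * (norm (x' t))\<^sup>2) \<le> E t\<^sub>0"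
      using coercive[of t] E_le[OF that] by linarith
    then have "(t * norm (x' t))\<^sup>2 \<le> E t\<^sub>0 / (K - 1 / (\<alpha> - 1))"
      using K by (subst pos_le_divide_eq) (auto simp: mult.commute power_mult_distrib)
    then have "t * norm (x' t) \<le> V" unfolding V_def by (rule real_le_rsqrt)
    then show ?thesis using that t0 by (simp add: field_simps)
  qed
  have w_bd: "norm (x'' t) \<le> (\<alpha> * V + R * \<alpha>\<^sup>2 / (1 + \<epsilon>)) * (1 / t\<^sup>2)" if "t > t\<^sub>0" for t
  proof -
    have tp: "t > 0" using that t0 by simp
    have "norm (yosida (lam t) A (x t)) \<le> norm (x t - z) / lam t"
      by (rule norm_yosida_le[OF max lam_pos[OF tp] z])
    also have "\<dots> \<le> R / lam t"
      using x_bd[of t] that lam_pos[OF tp] by (intro divide_right_mono) auto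
    finally have Y: "norm (yosida (lam t) A (x t)) \<le> R / lam t" .
    have "x'' t = - ((\<alpha> / t) *\<^sub>R x' t) - yosida (lam t) A (x t)"
      using ode[OF that] by (metis add.assoc eq_neg_iff_add_eq_0 minus_add_distrib uminus_add_conv_diff add_uminus_conv_diff)
    then have "norm (x'' t) \<le> (\<alpha> / t) * norm (x' t) + norm (yosida (lam t) A (x t))"
      using norm_triangle_ineq4[of "- ((\<alpha> / t) *\<^sub>R x' t)"] tp al by simp
    also have "\<dots> \<le> (\<alpha> / t) * (V / t) + R / lam t"
      using v_bd[of t] that tp al Y by (intro add_mono mult_left_mono) auto
    also have "\<dots> = (\<alpha> * V + R * \<alpha>\<^sup>2 / (1 + \<epsilon>)) * (1 / t\<^sup>2)"
      by (simp add: lam add_divide_distrib power2_eq_square)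
    finally show ?thesis .
  qed
  have "bounded (x ` {t\<^sub>0..})"
    using x_bd by (auto simp: bounded_def dist_norm norm_minus_commute intro!: exI[of _ z] exI[of _ R])
  moreover have "(\<lambda>t. norm (x' t)) \<in> O[at_top](\<lambda>t. 1 / t)"
    using v_bd t0 by (intro bigoI[of _ V] eventually_at_top_linorderI[of t\<^sub>0]) auto
  moreover have "(\<lambda>t. norm (x'' t)) \<in> O[at_top](\<lambda>t. 1 / t^2)"
    using w_bd by (intro bigoI[where c = "\<alpha> * V + R * \<alpha>\<^sup>2 / (1 + \<epsilon>)"]
        eventually_mono[OF eventually_gt_at_top[of t\<^sub>0]]) auto
  moreover have "set_integrable lborel {t\<^sub>0..} g"
  proof (rule set_integrable_atLeast_nonneg_bounded[OF cg g_nonneg])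
    fix b assume b: "t\<^sub>0 \<le> b"
    have "0 \<le> (\<alpha> - 1) / 4 * (norm (x b - z))\<^sup>2" "0 \<le> (K - 1 / (\<alpha> - 1)) * (b\<^sup>2 * (norm (x' b))\<^sup>2)"
      using al K by simp_all
    then have "0 \<le> E b" using coercive[of b] by linarith
    then show "integral {t\<^sub>0..b} g \<le> E t\<^sub>0 / c"
      using E_drop[OF b] c by (simp add: field_simps)
  qed
  ultimately show ?thesis by (simp add: g_def [abs_def])
qed

end
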